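(* Let $(X,\tau_1,\tau_2)$ be a bitopological space and let $i,j\in\{1,2\}$, $i\neq j$. The following conditions are equivalent: (1) $(X,\tau_1,\tau_2)$ is $(i,j)$-submaximal. (2) Every subset of $X$ is co-$(i,j)$-locally closed. (3) Every $j$-boundary subset of $X$ is $i$-closed. (4) $\tau_j\mathrm{cl}\,A\setminus A$ is $i$-closed for every subset $A\subset X$. (5) Every $j$-dense subset of $X$ is $i$-open.
   Context: A bitopological space $(X,\tau_1,\tau_2)$ is a set with two topologies; $\tau_i\mathrm{cl}$ and $\tau_i\mathrm{int}$ denote closure and interior in $\tau_i$; "$i$-open", "$i$-closed", "$i$-dense" refer to $\tau_i$. A subset $A\subset X$ is $(i,j)$-locally closed if for each $x\in A$ there is $U\in\tau_i$ with $x\in U$ and $U\cap A=U\cap\tau_j\mathrm{cl}\,A$ (equivalently, $A=U\cap F$ with $U\in\tau_i$ and $F$ $\tau_j$-closed). $A$ is co-$(i,j)$-locally closed if $X\setminus A$ is $(i,j)$-locally closed. $(X,\tau_1,\tau_2)$ is $(i,j)$-submaximal if every subset of $X$ is $(i,j)$-locally closed. $A$ is $j$-boundary if $\tau_j\mathrm{int}\,A=\varnothing$. *)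

theory Defs
  imports "HOL-Analysis.Abstract_Topology"
begin

(* The two topologies are given as a family indexed by nat; only the values tau 1 and tau 2
   matter. The indices i, j range over {1, 2}. *)

definition bitopological_space :: "'a set \<Rightarrow> (nat \<Rightarrow> 'a topology) \<Rightarrow> bool" where
  "bitopological_space X \<tau> \<longleftrightarrow> topspace (\<tau> 1) = X \<and> topspace (\<tau> 2) = X"

definition locally_closed_in ::
    "'a set \<Rightarrow> (nat \<Rightarrow> 'a topology) \<Rightarrow> nat \<Rightarrow> nat \<Rightarrow> 'a set \<Rightarrow> bool" where
  "locally_closed_in X \<tau> i j A \<longleftrightarrow>
     A \<subseteq> X \<and> (\<forall>x\<in>A. \<exists>U. openin (\<tau> i) U \<and> x \<in> U \<and> U \<inter> A = U \<inter> (\<tau> j closure_of A))"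

definition co_locally_closed_in ::
    "'a set \<Rightarrow> (nat \<Rightarrow> 'a topology) \<Rightarrow> nat \<Rightarrow> nat \<Rightarrow> 'a set \<Rightarrow> bool" where
  "co_locally_closed_in X \<tau> i j A \<longleftrightarrow> A \<subseteq> X \<and> locally_closed_in X \<tau> i j (X - A)"

definition submaximal ::
    "'a set \<Rightarrow> (nat \<Rightarrow> 'a topology) \<Rightarrow> nat \<Rightarrow> nat \<Rightarrow> bool" where
  "submaximal X \<tau> i j \<longleftrightarrow> (\<forall>A. A \<subseteq> X \<longrightarrow> locally_closed_in X \<tau> i j A)"

definition boundary_in :: "'a set \<Rightarrow> (nat \<Rightarrow> 'a topology) \<Rightarrow> nat \<Rightarrow> 'a set \<Rightarrow> bool" where
  "boundary_in X \<tau> j A \<longleftrightarrow> A \<subseteq> X \<and> \<tau> j interior_of A = {}"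

definition dense_in :: "'a set \<Rightarrow> (nat \<Rightarrow> 'a topology) \<Rightarrow> nat \<Rightarrow> 'a set \<Rightarrow> bool" where
  "dense_in X \<tau> j A \<longleftrightarrow> A \<subseteq> X \<and> \<tau> j closure_of A = X"

lemma locally_closed_in_iff_Int:
  assumes "bitopological_space X \<tau>" "i \<in> {1, 2}" "j \<in> {1, 2}"
  shows "locally_closed_in X \<tau> i j A \<longleftrightarrow>
    (\<exists>U F. openin (\<tau> i) U \<and> closedin (\<tau> j) F \<and> A = U \<inter> F)"
proof
  have ts: "topspace (\<tau> i) = X" "topspace (\<tau> j) = X"
    using assms by (auto simp: bitopological_space_def)
  {
    assume lc: "locally_closed_in X \<tau> i j A"
    let ?S = "{U. openin (\<tau> i) U \<and> U \<inter> A = U \<inter> (\<tau> j closure_of A)}"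
    have "A = \<Union>?S \<inter> (\<tau> j closure_of A)"
      using lc closure_of_subset[of A "\<tau> j"] ts
      unfolding locally_closed_in_def by fastforce
    moreover have "openin (\<tau> i) (\<Union>?S)"
      by (rule openin_Union) blast
    ultimately show "\<exists>U F. openin (\<tau> i) U \<and> closedin (\<tau> j) F \<and> A = U \<inter> F"
      using closedin_closure_of by blast
  next
    assume "\<exists>U F. openin (\<tau> i) U \<and> closedin (\<tau> j) F \<and> A = U \<inter> F"
    then obtain U F where UF: "openin (\<tau> i) U" "closedin (\<tau> j) F" "A = U \<inter> F" by blast
    have sub: "A \<subseteq> X" using UF openin_subset[OF UF(1)] ts by blast
    have "\<tau> j closure_of A \<subseteq> F"
      using UF by (intro closure_of_minimal) auto
    moreover have "A \<subseteq> \<tau> j closure_of A"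
      using sub ts by (simp add: closure_of_subset)
    ultimately have "U \<inter> A = U \<inter> (\<tau> j closure_of A)" using UF(3) by blast
    with UF sub show "locally_closed_in X \<tau> i j A"
      unfolding locally_closed_in_def by blast
  }
qed

end

theory Submission
  imports Defs
begin

text \<open>Complementation in \<open>X\<close> links submaximality with its co-version, and
  boundary sets with dense ones (\<open>boundary_in_iff_dense_in_Compl\<close>). The other
  conditions form a cycle. If a j-dense set is \<open>U \<inter> F\<close> with \<open>U\<close>
  i-open and \<open>F\<close> j-closed, density forces \<open>F\<close> to be everything, so the set
  is \<open>U\<close>. The complement of \<open>\<tau> j closure_of A - A\<close> is j-dense by
  \<open>dense_in_Un_Compl_closure\<close>, hence i-open once dense sets are i-open. Finally,
  \<open>A\<close> is its j-closure intersected with that complement, hence locally closed.\<close>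

lemma dense_in_Un_Compl_closure:
  assumes "topspace (\<tau> j) = X" and "A \<subseteq> X"
  shows "dense_in X \<tau> j (A \<union> (X - \<tau> j closure_of A))"
proof -
  \<comment> \<open>A point outside the closure of \<open>A\<close> lies in the second piece, hence
    in the closure of that piece.\<close>
  have "X \<subseteq> \<tau> j closure_of A \<union> \<tau> j closure_of (X - \<tau> j closure_of A)"
    using closure_of_subset[of "X - \<tau> j closure_of A" "\<tau> j"] assms by auto
  then show ?thesis
    using assms closure_of_subset_topspace[of "\<tau> j"]
    by (auto simp: dense_in_def closure_of_Un)
qed

text \<open>The interior of \<open>A\<close> is \<open>X\<close> minus the closure of
  \<open>X - A\<close>, so it is empty exactly when that closure fills \<open>X\<close>.\<close>

lemma boundary_in_iff_dense_in_Compl: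
  assumes "topspace (\<tau> j) = X" and "A \<subseteq> X"
  shows "boundary_in X \<tau> j A \<longleftrightarrow> dense_in X \<tau> j (X - A)"
  using assms closure_of_subset_topspace[of "\<tau> j" "X - A"]
  by (auto simp: boundary_in_def dense_in_def interior_of_closure_of)

theorem theorem3p2:
  fixes X :: "'a set" and \<tau> :: "nat \<Rightarrow> 'a topology" and i j :: nat
  assumes "bitopological_space X \<tau>"
    and "i \<in> {1, 2}" and "j \<in> {1, 2}" and "i \<noteq> j"
  shows "(submaximal X \<tau> i j \<longleftrightarrow> (\<forall>A. A \<subseteq> X \<longrightarrow> co_locally_closed_in X \<tau> i j A))
    \<and> (submaximal X \<tau> i j \<longleftrightarrow> (\<forall>A. A \<subseteq> X \<longrightarrow> boundary_in X \<tau> j A \<longrightarrow> closedin (\<tau> i) A))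
    \<and> (submaximal X \<tau> i j \<longleftrightarrow> (\<forall>A. A \<subseteq> X \<longrightarrow> closedin (\<tau> i) ((\<tau> j closure_of A) - A)))
    \<and> (submaximal X \<tau> i j \<longleftrightarrow> (\<forall>A. A \<subseteq> X \<longrightarrow> dense_in X \<tau> j A \<longrightarrow> openin (\<tau> i) A))"
proof -
  have ts: "topspace (\<tau> i) = X" "topspace (\<tau> j) = X"
    using assms by (auto simp: bitopological_space_def)
  note lc_iff = locally_closed_in_iff_Int[OF assms(1-3)]
  let ?co = "\<forall>A. A \<subseteq> X \<longrightarrow> co_locally_closed_in X \<tau> i j A"
  let ?bd = "\<forall>A. A \<subseteq> X \<longrightarrow> boundary_in X \<tau> j A \<longrightarrow> closedin (\<tau> i) A"
  let ?fr = "\<forall>A. A \<subseteq> X \<longrightarrow> closedin (\<tau> i) ((\<tau> j closure_of A) - A)"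
  let ?de = "\<forall>A. A \<subseteq> X \<longrightarrow> dense_in X \<tau> j A \<longrightarrow> openin (\<tau> i) A"
  \<comment> \<open>Complementation is an involution on the subsets of \<open>X\<close>, so
    quantifiers over them can be reindexed by it. This serves both complement equivalences
    below.\<close>
  have all_Compl: "(\<forall>A. A \<subseteq> X \<longrightarrow> P (X - A)) \<longleftrightarrow> (\<forall>A. A \<subseteq> X \<longrightarrow> P A)" for P
  proof (intro iffI allI impI)
    fix A assume "\<forall>A. A \<subseteq> X \<longrightarrow> P (X - A)" and "A \<subseteq> X"
    then have "P (X - (X - A))" by (meson Diff_subset)
    with \<open>A \<subseteq> X\<close> show "P A" by (simp add: double_diff)
  next
    fix A assume "\<forall>A. A \<subseteq> X \<longrightarrow> P A"
    then show "P (X - A)" by (meson Diff_subset)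
  qed
  have "submaximal X \<tau> i j \<longleftrightarrow> ?co"
    using all_Compl[of "locally_closed_in X \<tau> i j"]
    by (simp add: submaximal_def co_locally_closed_in_def)
  moreover have "?bd \<longleftrightarrow> ?de"
  proof -
    have "?bd \<longleftrightarrow> (\<forall>A. A \<subseteq> X \<longrightarrow> dense_in X \<tau> j (X - A) \<longrightarrow> openin (\<tau> i) (X - A))"
      using boundary_in_iff_dense_in_Compl[of \<tau> j, OF ts(2)] ts
      by (simp add: closedin_def)
    with all_Compl[of "\<lambda>A. dense_in X \<tau> j A \<longrightarrow> openin (\<tau> i) A"] show ?thesis
      by argo
  qed
  moreover have "?de" if "submaximal X \<tau> i j"
  proof (intro allI impI)
    fix A assume A: "A \<subseteq> X" "dense_in X \<tau> j A"
    with that obtain U F where UF: "openin (\<tau> i) U" "closedin (\<tau> j) F" "A = U \<inter> F"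
      unfolding submaximal_def lc_iff by blast
    \<comment> \<open>\<open>F\<close> is j-closed and contains \<open>A\<close>, so it contains the
      closure of \<open>A\<close>, which is \<open>X\<close>; intersecting with \<open>F\<close>
      thus removes nothing from \<open>U\<close>.\<close>
    have "X \<subseteq> F"
      using A UF closure_of_minimal[of A F "\<tau> j"] by (auto simp: dense_in_def)
    then have "A = U"
      using UF openin_subset ts by fastforce
    with UF show "openin (\<tau> i) A" by simp
  qed
  moreover have "?fr" if "?de"
  proof (intro allI impI)
    fix A assume A: "A \<subseteq> X"
    have "X - (\<tau> j closure_of A - A) = A \<union> (X - \<tau> j closure_of A)"
      using A by blast
    moreover have "openin (\<tau> i) (A \<union> (X - \<tau> j closure_of A))"
      using that dense_in_Un_Compl_closure[of \<tau> j, OF ts(2) A] A by simp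
    ultimately show "closedin (\<tau> i) (\<tau> j closure_of A - A)"
      using closure_of_subset_topspace[of "\<tau> j" A] ts by (auto simp: closedin_def)
  qed
  moreover have "submaximal X \<tau> i j" if "?fr"
    unfolding submaximal_def lc_iff
  proof (intro allI impI exI conjI)
    fix A assume A: "A \<subseteq> X"
    \<comment> \<open>The witness for \<open>U\<close> discards exactly the points that the
      j-closure adds to \<open>A\<close>; the witness for \<open>F\<close> is the j-closure
      itself.\<close>
    show "openin (\<tau> i) (X - (\<tau> j closure_of A - A))"
      using that A ts by (auto simp: closedin_def)
    show "closedin (\<tau> j) (\<tau> j closure_of A)" by simp
    show "A = (X - (\<tau> j closure_of A - A)) \<inter> \<tau> j closure_of A"
      using A closure_of_subset[of A "\<tau> j"] ts by auto
  qed
  ultimately show ?thesis by argo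
qed

end
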